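(* Let $R\subset\mathbb{C}^n$ be any complete Reinhardt domain. Then $K_n^p(H^\infty(R,X))>0$ for all complex Banach spaces $X$ and for all $p\in(0,\infty)$.
   Context: A complete Reinhardt domain $R\subset\mathbb{C}^n$ is a domain such that if $z=(z_1,\dots,z_n)\in R$ and $x=(x_1,\dots,x_n)\in\mathbb{C}^n$ satisfies $|x_i|\le|z_i|$ for all $1\le i\le n$, then $x\in R$. Multi-index notation: $\alpha=(\alpha_1,\dots,\alpha_n)$ is an $n$-tuple of nonnegative integers, $|\alpha|=\alpha_1+\cdots+\alpha_n$, $z^\alpha=z_1^{\alpha_1}\cdots z_n^{\alpha_n}$. $H^\infty(R,X)$ is the space of $X$-valued holomorphic functions on $R$ that are bounded with respect to the sup-norm $\|f\|_\infty=\sup_{z\in R}\|f(z)\|$. $K_n^p(H^\infty(R,X))$ is the supremum of all $r\in[0,1]$ such that $$\sup_{z\in rR}\sum_{k=1}^\infty\sum_{|\alpha|=k}\|x_\alpha z^\alpha\|^p\le1$$ for all $f(z)=\sum_{k=0}^\infty\sum_{|\alpha|=k}x_\alpha z^\alpha\in H^\infty(R,X)$ (with $x_\alpha\in X$) satisfying $\|f\|_\infty\le1$. (The sum starts at $k=1$.) *)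

theory Defs
  imports "HOL-Analysis.Analysis"
begin

text \<open>The real structure inherited from class \<open>banach\<close> is the restriction of the complex one.\<close>

class cbanach = banach +
  fixes scaleC :: "complex \<Rightarrow> 'a \<Rightarrow> 'a"  (infixr "*\<^sub>C" 75)
  assumes scaleC_add_right: "c *\<^sub>C (x + y) = c *\<^sub>C x + c *\<^sub>C y"
    and scaleC_add_left: "(c + d) *\<^sub>C x = c *\<^sub>C x + d *\<^sub>C x"
    and scaleC_scaleC: "c *\<^sub>C d *\<^sub>C x = (c * d) *\<^sub>C x"
    and scaleC_of_real: "complex_of_real r *\<^sub>C x = r *\<^sub>R x"
    and norm_scaleC: "norm (c *\<^sub>C x) = cmod c * norm x"

instantiation complex :: cbanach
begin

definition scaleC_complex :: "complex \<Rightarrow> complex \<Rightarrow> complex"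
  where "scaleC_complex c x = c * x"

instance
  by standard (simp_all add: scaleC_complex_def algebra_simps norm_mult scaleR_conv_of_real)

end

definition complete_reinhardt_domain :: "(complex ^ 'n) set \<Rightarrow> bool"
  where "complete_reinhardt_domain R \<longleftrightarrow>
    open R \<and> connected R \<and> R \<noteq> {} \<and>
    (\<forall>z\<in>R. \<forall>x. (\<forall>i. cmod (x $ i) \<le> cmod (z $ i)) \<longrightarrow> x \<in> R)"

definition mdeg :: "('n::finite \<Rightarrow> nat) \<Rightarrow> nat"
  where "mdeg \<alpha> = (\<Sum>i\<in>UNIV. \<alpha> i)"

definition monomial :: "complex ^ 'n \<Rightarrow> ('n \<Rightarrow> nat) \<Rightarrow> complex"
  where "monomial z \<alpha> = (\<Prod>i\<in>UNIV. (z $ i) ^ \<alpha> i)"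

text \<open>Complex Frechet differentiability at every point of an open set.\<close>

definition vholomorphic_on :: "(complex ^ 'n \<Rightarrow> 'x::cbanach) \<Rightarrow> (complex ^ 'n) set \<Rightarrow> bool"
  where "vholomorphic_on f R \<longleftrightarrow>
    (\<forall>z\<in>R. \<exists>D. (f has_derivative D) (at z) \<and> (\<forall>c v. D (c *s v) = c *\<^sub>C D v))"

definition Hinf :: "(complex ^ 'n) set \<Rightarrow> (complex ^ 'n \<Rightarrow> 'x::cbanach) set"
  where "Hinf R = {f. vholomorphic_on f R \<and> bounded (f ` R)}"

definition sup_norm_on :: "(complex ^ 'n) set \<Rightarrow> (complex ^ 'n \<Rightarrow> 'x::cbanach) \<Rightarrow> real"
  where "sup_norm_on R f = (SUP z\<in>R. norm (f z))"

definition has_monomial_expansion ::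
    "(complex ^ 'n \<Rightarrow> 'x::cbanach) \<Rightarrow> (('n \<Rightarrow> nat) \<Rightarrow> 'x) \<Rightarrow> (complex ^ 'n) set \<Rightarrow> bool"
  where "has_monomial_expansion f x R \<longleftrightarrow>
    (\<forall>z\<in>R. (\<lambda>k. \<Sum>\<alpha> | mdeg \<alpha> = k. monomial z \<alpha> *\<^sub>C x \<alpha>) sums f z)"

text \<open>
  The series of \<open>p\<close>-th powers is summed in \<open>ennreal\<close>, so that divergence counts as \<open>\<infinity>\<close>;
  the index \<open>Suc k\<close> makes it start in degree one.  The function space \<open>F\<close> (over \<open>R\<close>) is an
  argument and carries the type of the values.
\<close>

definition bohr_radius ::
    "real \<Rightarrow> (complex ^ 'n) set \<Rightarrow> (complex ^ 'n \<Rightarrow> 'x::cbanach) set \<Rightarrow> real"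
  where "bohr_radius p R F = Sup {r. 0 \<le> r \<and> r \<le> 1 \<and>
    (\<forall>f\<in>F. \<forall>x. has_monomial_expansion f x R \<and> sup_norm_on R f \<le> 1 \<longrightarrow>
      (SUP z\<in>(*\<^sub>R) r ` R.
        \<Sum>k. \<Sum>\<alpha> | mdeg \<alpha> = Suc k. ennreal (norm (monomial z \<alpha> *\<^sub>C x \<alpha>) powr p)) \<le> 1)}"

end

theory Submission imports Defs begin

text \<open>
  Averaging over roots of unity, first along the circle \<open>t \<mapsto> t z\<close> and then over the
  torus through \<open>z\<close>, gives the Cauchy estimate \<open>\<parallel>x\<^sub>\<alpha> z\<^sup>\<alpha>\<parallel> \<le> 1\<close>; no integration is needed,
  and openness of \<open>R\<close> makes the expansion absolutely convergent along the circle.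
  In dimension \<open>n\<close> there are at most \<open>n ^ k\<close> multi-indices of degree \<open>k\<close>, so any \<open>r\<close> with
  \<open>r powr p \<le> 1 / (2 n)\<close> bounds the Bohr sum on \<open>r R\<close> by \<open>\<Sum>k\<ge>1. (1 / 2) ^ k = 1\<close>.
\<close>

section \<open>Linearity of complex scalar multiplication\<close>

lemma bounded_linear_scaleC_right: "bounded_linear (\<lambda>x::'x::cbanach. c *\<^sub>C x)"
proof (rule bounded_linear_intro[where K = "cmod c"])
  show "c *\<^sub>C (r *\<^sub>R x) = r *\<^sub>R (c *\<^sub>C x)" for r and x :: 'x
    by (simp add: scaleC_of_real[symmetric] scaleC_scaleC mult.commute)
qed (simp_all add: scaleC_add_right norm_scaleC mult.commute)

lemma scaleC_sum_right: "c *\<^sub>C (\<Sum>i\<in>A. g i :: 'x::cbanach) = (\<Sum>i\<in>A. c *\<^sub>C g i)"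
  by (rule linear_sum[OF bounded_linear.linear[OF bounded_linear_scaleC_right]])

lemma scaleC_zero_left [simp]: "0 *\<^sub>C (x::'x::cbanach) = 0"
  using scaleC_of_real[of 0 x] by simp

lemma scaleC_sum_left: "(\<Sum>i\<in>A. g i) *\<^sub>C (x::'x::cbanach) = (\<Sum>i\<in>A. g i *\<^sub>C x)"
  by (induction A rule: infinite_finite_induct) (simp_all add: scaleC_add_left)

section \<open>Coefficient bounds from averages over roots of unity\<close>

text \<open>Weighting the sums by \<open>cnj (\<phi> j a)\<close> and adding over \<open>J\<close>
  leaves only \<open>card J\<close> copies of \<open>x a\<close>; the weights have modulus 1, so the
  triangle inequality gives at most \<open>card J * B\<close>. The index sets are abstract so that
  both the circle and the torus are covered.\<close>

lemma norm_coeff_le_of_orthogonal: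
  fixes x :: "'a \<Rightarrow> 'x::cbanach" and \<phi> :: "'j \<Rightarrow> 'a \<Rightarrow> complex"
  assumes A: "finite A" "a \<in> A" and J: "finite J" "J \<noteq> {}"
    and unit: "\<And>j. j \<in> J \<Longrightarrow> cmod (\<phi> j a) = 1"
    and orth: "\<And>b. b \<in> A \<Longrightarrow>
      (\<Sum>j\<in>J. cnj (\<phi> j a) * \<phi> j b) = (if a = b then of_nat (card J) else 0)"
    and bound: "\<And>j. j \<in> J \<Longrightarrow> norm (\<Sum>b\<in>A. \<phi> j b *\<^sub>C x b) \<le> B"
  shows "norm (x a) \<le> B"
proof -
  have "(\<Sum>j\<in>J. cnj (\<phi> j a) *\<^sub>C (\<Sum>b\<in>A. \<phi> j b *\<^sub>C x b))
      = (\<Sum>b\<in>A. (\<Sum>j\<in>J. cnj (\<phi> j a) * \<phi> j b) *\<^sub>C x b)"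
    by (simp add: scaleC_sum_right scaleC_sum_left scaleC_scaleC sum.swap[of _ A])
  also have "\<dots> = (\<Sum>b\<in>A. if a = b then of_nat (card J) *\<^sub>C x b else 0)"
    by (intro sum.cong) (auto simp: orth)
  also have "\<dots> = complex_of_real (real (card J)) *\<^sub>C x a"
    using A by simp
  finally have eq: "(\<Sum>j\<in>J. cnj (\<phi> j a) *\<^sub>C (\<Sum>b\<in>A. \<phi> j b *\<^sub>C x b))
      = complex_of_real (real (card J)) *\<^sub>C x a" .
  have "real (card J) * norm (x a) \<le> (\<Sum>j\<in>J. norm (cnj (\<phi> j a) *\<^sub>C (\<Sum>b\<in>A. \<phi> j b *\<^sub>C x b)))"
    using norm_sum[of "\<lambda>j. cnj (\<phi> j a) *\<^sub>C (\<Sum>b\<in>A. \<phi> j b *\<^sub>C x b)" J]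
    unfolding eq norm_scaleC by simp
  also have "\<dots> \<le> (\<Sum>j\<in>J. B)"
    by (intro sum_mono) (simp add: norm_scaleC unit bound)
  finally show ?thesis
    using J by (simp add: card_gt_0_iff)
qed

lemma sum_roots_unity_orthogonal:
  assumes "m < N" "l < N"
  shows "(\<Sum>j<N. cnj (cis (2 * pi * real j / real N) ^ m) * cis (2 * pi * real j / real N) ^ l)
    = (if m = l then of_nat N else 0)"
proof -
  define \<zeta> where "\<zeta> m = cis (2 * pi * real m / real N)" for m
  \<comment> \<open>Exchanging index and exponent turns the sum over \<open>j\<close> into a
    geometric one with ratio \<open>u\<close>, an \<open>N\<close>-th root of unity that equals 1
    only for \<open>m = l\<close>.\<close>
  have swap: "cis (2 * pi * real j / real N) ^ m = \<zeta> m ^ j" for j m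
    unfolding \<zeta>_def Complex.DeMoivre by (rule arg_cong[where f = cis]) simp
  define u where "u = cnj (\<zeta> m) * \<zeta> l"
  have unit: "\<zeta> m * cnj (\<zeta> m) = 1"
    by (simp add: \<zeta>_def complex_mult_cnj flip: cmod_power2)
  have "\<zeta> k ^ N = 1" for k
    using assms by (simp add: \<zeta>_def Complex.DeMoivre cis_multiple_2pi)
  then have uN: "u ^ N = 1"
    by (simp add: u_def power_mult_distrib flip: complex_cnj_power)
  have sum_eq: "(\<Sum>j<N. cnj (cis (2 * pi * real j / real N) ^ m) * cis (2 * pi * real j / real N) ^ l)
      = (\<Sum>j<N. u ^ j)"
    by (simp add: swap u_def power_mult_distrib)
  show ?thesis
  proof (cases "m = l")
    case True
    then show ?thesis
      using unit unfolding sum_eq by (simp add: u_def mult.commute)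
  next
    case False
    have "u \<noteq> 1"
    proof
      assume "u = 1"
      then have "\<zeta> m = \<zeta> l"
        using unit by (simp add: u_def) (metis mult.assoc mult.right_neutral mult_1)
      moreover have "inj_on \<zeta> {..<N}"
        using Complex.bij_betw_roots_unity[of N] assms by (auto simp: bij_betw_def \<zeta>_def[abs_def])
      ultimately show False
        using assms False by (auto dest: inj_onD)
    qed
    then show ?thesis
      using False uN unfolding sum_eq by (simp add: geometric_sum)
  qed
qed

text \<open>The \<open>N\<close>-th roots of unity separate exponents only modulo \<open>N\<close>.
  So the series is cut at \<open>N\<close>, the rest is charged to the error \<open>tail N\<close>,
  and \<open>N\<close> tends to infinity.\<close>

lemma norm_power_series_coeff_le:
  fixes a :: "nat \<Rightarrow> 'x::cbanach"
  assumes summ: "summable (\<lambda>k. norm (a k))"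
    and sums: "\<And>t. cmod t = 1 \<Longrightarrow> (\<lambda>k. t ^ k *\<^sub>C a k) sums f t"
    and bound: "\<And>t. cmod t = 1 \<Longrightarrow> norm (f t) \<le> B"
  shows "norm (a k) \<le> B"
proof -
  define tail where "tail N = (\<Sum>m. norm (a (m + N)))" for N
  have part: "norm (\<Sum>m<N. t ^ m *\<^sub>C a m) \<le> B + tail N" if t: "cmod t = 1" for t N
  proof -
    have nt: "norm (t ^ m *\<^sub>C a m) = norm (a m)" for m
      by (simp add: norm_scaleC norm_power t)
    have s: "summable (\<lambda>m. norm (t ^ (m + N) *\<^sub>C a (m + N)))"
      unfolding nt using summ by (subst summable_iff_shift)
    have "(\<lambda>m. t ^ (m + N) *\<^sub>C a (m + N)) sums (f t - (\<Sum>m<N. t ^ m *\<^sub>C a m))"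
      by (rule sums_split_initial_segment[OF sums[OF t]])
    then have "norm (f t - (\<Sum>m<N. t ^ m *\<^sub>C a m)) \<le> tail N"
      using summable_norm[OF s] unfolding nt tail_def by (simp add: sums_iff)
    then show ?thesis
      using bound[OF t] norm_triangle_ineq3[of "f t" "\<Sum>m<N. t ^ m *\<^sub>C a m"] by linarith
  qed
  have "norm (a k) \<le> B + tail N" if "N > k" for N
  proof (rule norm_coeff_le_of_orthogonal[where A = "{..<N}" and J = "{..<N}"
        and \<phi> = "\<lambda>j m. cis (2 * pi * real j / real N) ^ m"])
    show "norm (\<Sum>b<N. cis (2 * pi * real j / real N) ^ b *\<^sub>C a b) \<le> B + tail N" for j
      by (rule part) simp
  qed (use that in \<open>auto simp: sum_roots_unity_orthogonal norm_power simp del: complex_cnj_power\<close>)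
  then have "\<forall>\<^sub>F N in sequentially. norm (a k) \<le> B + tail N"
    using eventually_gt_at_top[of k] by (rule eventually_mono[rotated])
  moreover have "(\<lambda>N. B + tail N) \<longlonglongrightarrow> B + 0"
    unfolding tail_def by (intro tendsto_intros suminf_exist_split2[OF summ])
  ultimately show ?thesis
    using tendsto_lowerbound[of "\<lambda>N. B + tail N" "B + 0" sequentially "norm (a k)"] by simp
qed

section \<open>Multi-indices and monomials\<close>

text \<open>Each multi-index of degree \<open>k + 1\<close> arises from one of degree
  \<open>k\<close> by raising one of the \<open>n\<close> entries. Finiteness is carried along
  because an infinite set has \<open>card\<close> 0, which would make the bound alone
  worthless.\<close>

lemma card_mdeg_le:
  "finite {\<alpha> :: 'n::finite \<Rightarrow> nat. mdeg \<alpha> = k} \<and>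
    card {\<alpha> :: 'n \<Rightarrow> nat. mdeg \<alpha> = k} \<le> CARD('n) ^ k"
proof (induction k)
  case 0
  have "{\<alpha> :: 'n \<Rightarrow> nat. mdeg \<alpha> = 0} = {\<lambda>_. 0}"
    by (auto simp: mdeg_def)
  then show ?case by simp
next
  case (Suc k)
  define S where "S = {\<alpha> :: 'n \<Rightarrow> nat. mdeg \<alpha> = k}"
  have sub: "{\<alpha> :: 'n \<Rightarrow> nat. mdeg \<alpha> = Suc k} \<subseteq> (\<lambda>(i, \<alpha>). \<alpha>(i := Suc (\<alpha> i))) ` (UNIV \<times> S)"
  proof
    fix \<alpha> :: "'n \<Rightarrow> nat"
    assume "\<alpha> \<in> {\<alpha>. mdeg \<alpha> = Suc k}"
    then have deg: "(\<Sum>i\<in>UNIV. \<alpha> i) = Suc k"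
      by (simp add: mdeg_def)
    then obtain i where i: "\<alpha> i \<noteq> 0"
      by (metis nat.simps(3) sum.neutral)
    define \<beta> where "\<beta> = \<alpha>(i := \<alpha> i - 1)"
    have "mdeg \<beta> = (\<alpha> i - 1) + (\<Sum>j\<in>UNIV - {i}. \<alpha> j)"
      unfolding mdeg_def \<beta>_def by (subst sum.remove[of _ i]) auto
    moreover have "(\<Sum>j\<in>UNIV. \<alpha> j) = \<alpha> i + (\<Sum>j\<in>UNIV - {i}. \<alpha> j)"
      by (subst sum.remove[of _ i]) auto
    ultimately have "\<beta> \<in> S"
      using deg i by (simp add: S_def)
    moreover have "\<alpha> = \<beta>(i := Suc (\<beta> i))"
      using i by (auto simp: \<beta>_def)
    ultimately show "\<alpha> \<in> (\<lambda>(i, \<alpha>). \<alpha>(i := Suc (\<alpha> i))) ` (UNIV \<times> S)"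
      by force
  qed
  have fin: "finite ((UNIV :: 'n set) \<times> S)"
    using Suc by (simp add: S_def)
  have "card {\<alpha> :: 'n \<Rightarrow> nat. mdeg \<alpha> = Suc k} \<le> card ((UNIV :: 'n set) \<times> S)"
    by (rule order_trans[OF card_mono[OF _ sub] card_image_le]) (use fin in auto)
  also have "\<dots> \<le> CARD('n) ^ Suc k"
    using Suc by (simp add: card_cartesian_product S_def)
  finally show ?case
    using finite_subset[OF sub] fin by blast
qed

lemma le_mdeg: "\<alpha> i \<le> mdeg \<alpha>"
  unfolding mdeg_def by (rule member_le_sum) auto

lemma monomial_scale: "monomial (\<chi> i. c i * z $ i) \<alpha> = (\<Prod>i\<in>UNIV. c i ^ \<alpha> i) * monomial z \<alpha>"
  by (simp add: monomial_def power_mult_distrib prod.distrib)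

lemma monomial_scale_const: "monomial (\<chi> i. c * z $ i) \<alpha> = c ^ mdeg \<alpha> * monomial z \<alpha>"
  unfolding monomial_scale mdeg_def by (simp add: power_sum)

lemma scaleR_vec_eq: "s *\<^sub>R z = (\<chi> i. complex_of_real s * z $ i)"
  by (simp add: vec_eq_iff) (simp add: scaleR_conv_of_real)

section \<open>Averaging over the torus\<close>

lemma norm_homogeneous_coeff_le:
  fixes x :: "('n::finite \<Rightarrow> nat) \<Rightarrow> 'x::cbanach"
  assumes bound: "\<And>w. (\<And>i. cmod (w $ i) = cmod (z $ i)) \<Longrightarrow>
      norm (\<Sum>\<alpha> | mdeg \<alpha> = k. monomial w \<alpha> *\<^sub>C x \<alpha>) \<le> B"
    and \<alpha>: "mdeg \<alpha> = k"
  shows "norm (monomial z \<alpha> *\<^sub>C x \<alpha>) \<le> B"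
proof -
  \<comment> \<open>All entries of a multi-index of degree \<open>k\<close> are below
    \<open>N\<close>, so the \<open>N\<close>-th roots of unity in each coordinate tell such
    multi-indices apart.\<close>
  define N where "N = Suc k"
  define e where "e j = cis (2 * pi * real j / real N)" for j
  define J where "J = (UNIV :: 'n set) \<rightarrow>\<^sub>E {..<N}"
  have cmod_e: "cmod (e j) = 1" for j
    by (simp add: e_def)
  have orth: "(\<Sum>j\<in>J. cnj (\<Prod>i\<in>UNIV. e (j i) ^ \<alpha> i) * (\<Prod>i\<in>UNIV. e (j i) ^ \<beta> i))
      = (if \<alpha> = \<beta> then of_nat (card J) else 0)" if "mdeg \<beta> = k" for \<beta>
  proof -
    have "\<alpha> i < N" "\<beta> i < N" for i
      using le_mdeg[of \<alpha> i] le_mdeg[of \<beta> i] \<alpha> that by (simp_all add: N_def)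
    note orth1 = sum_roots_unity_orthogonal[OF this, folded e_def]
    have "(\<Sum>j\<in>J. cnj (\<Prod>i\<in>UNIV. e (j i) ^ \<alpha> i) * (\<Prod>i\<in>UNIV. e (j i) ^ \<beta> i))
        = (\<Sum>j\<in>J. \<Prod>i\<in>UNIV. cnj (e (j i) ^ \<alpha> i) * e (j i) ^ \<beta> i)"
      by (simp add: prod.distrib cnj_prod)
    \<comment> \<open>Summing over the full grid \<open>J\<close> factors into one-dimensional sums;
      a single coordinate with different exponents makes the product vanish.\<close>
    also have "\<dots> = (\<Prod>i\<in>UNIV. \<Sum>l<N. cnj (e l ^ \<alpha> i) * e l ^ \<beta> i)"
      unfolding J_def by (rule prod_sum_PiE[symmetric]) auto
    also have "\<dots> = (\<Prod>i\<in>UNIV. if \<alpha> i = \<beta> i then of_nat N else 0)"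
      by (simp only: orth1)
    also have "\<dots> = (if \<alpha> = \<beta> then of_nat (card J) else 0)"
      by (auto simp: J_def card_PiE fun_eq_iff intro!: prod_zero)
    finally show ?thesis .
  qed
  show ?thesis
  \<comment> \<open>The whole term at \<open>z\<close>, not \<open>x \<alpha>\<close>, plays the
    coefficient: nothing is divided by coordinates of \<open>z\<close>, which may be 0.\<close>
  proof (rule norm_coeff_le_of_orthogonal[where A = "{\<beta>. mdeg \<beta> = k}" and J = J
        and \<phi> = "\<lambda>j \<beta>. \<Prod>i\<in>UNIV. e (j i) ^ \<beta> i" and x = "\<lambda>\<alpha>. monomial z \<alpha> *\<^sub>C x \<alpha>"])
    show "finite J" "J \<noteq> {}"
      by (auto simp: J_def N_def PiE_eq_empty_iff intro!: finite_PiE)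
    show "norm (\<Sum>\<beta> | mdeg \<beta> = k. (\<Prod>i\<in>UNIV. e (j i) ^ \<beta> i) *\<^sub>C monomial z \<beta> *\<^sub>C x \<beta>) \<le> B" for j
      using bound[of "\<chi> i. e (j i) * z $ i"]
      by (simp add: norm_mult cmod_e monomial_scale scaleC_scaleC)
  qed (use \<alpha> card_mdeg_le orth in \<open>auto simp: prod_norm[symmetric] norm_power cmod_e\<close>)
qed

section \<open>Cauchy estimates on a complete Reinhardt domain\<close>

lemma open_imp_scale_mem:
  fixes z :: "'a::real_normed_vector"
  assumes "open R" "z \<in> R"
  obtains s where "s > 1" "s *\<^sub>R z \<in> R"
proof -
  have "((\<lambda>s. s *\<^sub>R z) \<longlongrightarrow> 1 *\<^sub>R z) (at_right 1)"
    by (intro tendsto_intros)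
  then have "\<forall>\<^sub>F s in at_right 1. s *\<^sub>R z \<in> R"
    using assms by (intro topological_tendstoD) auto
  then have "\<forall>\<^sub>F s in at_right (1::real). s > 1 \<and> s *\<^sub>R z \<in> R"
    by (intro eventually_conj eventually_at_right_less)
  then show thesis
    using that eventually_happens[of _ "at_right (1::real)"] by auto
qed

text \<open>Along the circle through \<open>z\<close>, \<open>f\<close> is a power series in
  \<open>t\<close> whose coefficients are its homogeneous parts at \<open>z\<close>, so the
  one-variable estimate applies.\<close>

lemma norm_homogeneous_part_le:
  fixes f :: "complex ^ 'n \<Rightarrow> 'x::cbanach"
  assumes R: "complete_reinhardt_domain R"
    and f: "has_monomial_expansion f x R" "\<And>z. z \<in> R \<Longrightarrow> norm (f z) \<le> B"
    and z: "z \<in> R"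
  shows "norm (\<Sum>\<alpha> | mdeg \<alpha> = k. monomial z \<alpha> *\<^sub>C x \<alpha>) \<le> B"
proof -
  define P where "P k w = (\<Sum>\<alpha> | mdeg \<alpha> = k. monomial w \<alpha> *\<^sub>C x \<alpha>)" for k w
  have P_scale: "P k (\<chi> i. c * w $ i) = c ^ k *\<^sub>C P k w" for k c w
    unfolding P_def scaleC_sum_right
    by (intro sum.cong) (auto simp: scaleC_scaleC monomial_scale_const)
  have P_sums: "(\<lambda>k. P k w) sums f w" if "w \<in> R" for w
    using f(1) that by (simp add: has_monomial_expansion_def P_def)
  have circle: "(\<chi> i. t * z $ i) \<in> R" if "cmod t = 1" for t
  proof -
    have "\<forall>i. cmod ((\<chi> i. t * z $ i) $ i) \<le> cmod (z $ i)"
      using that by (simp add: norm_mult)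
    then show ?thesis
      using R z unfolding complete_reinhardt_domain_def by blast
  qed
  \<comment> \<open>The expansion only provides convergence of the series of homogeneous parts.
    Convergence at the larger point \<open>s *\<^sub>R z\<close> keeps
    \<open>s ^ k *\<^sub>R P k z\<close> bounded, whence geometric decay of
    \<open>P k z\<close>.\<close>
  obtain s where s: "s > 1" "s *\<^sub>R z \<in> R"
    using R z open_imp_scale_mem unfolding complete_reinhardt_domain_def by blast
  have Ps: "P k (s *\<^sub>R z) = s ^ k *\<^sub>R P k z" for k
    by (simp add: scaleR_vec_eq P_scale flip: scaleC_of_real)
  have "(\<lambda>k. s ^ k *\<^sub>R P k z) \<longlonglongrightarrow> 0"
    using P_sums[OF s(2)] unfolding Ps by (intro summable_LIMSEQ_zero) (rule sums_summable)
  then have "Bseq (\<lambda>k. s ^ k *\<^sub>R P k z)"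
    by (intro convergent_imp_Bseq convergentI)
  then obtain C where C: "norm (s ^ k *\<^sub>R P k z) \<le> C" for k
    by (auto simp: Bseq_def)
  have summ: "summable (\<lambda>k. norm (P k z))"
  proof (rule summable_comparison_test')
    show "summable (\<lambda>k. C * (1 / s) ^ k)"
      using s by (intro summable_mult summable_geometric) simp
    show "norm (norm (P k z)) \<le> C * (1 / s) ^ k" for k
      using C[of k] s by (simp add: field_simps)
  qed
  have "norm (P k z) \<le> B"
  proof (rule norm_power_series_coeff_le[OF summ])
    fix t assume t: "cmod t = 1"
    show "(\<lambda>k. t ^ k *\<^sub>C P k z) sums f (\<chi> i. t * z $ i)"
      using P_sums[OF circle[OF t]] by (simp add: P_scale)
    show "norm (f (\<chi> i. t * z $ i)) \<le> B"
      by (rule f(2)[OF circle[OF t]])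
  qed
  then show ?thesis
    by (simp add: P_def)
qed

text \<open>Completeness puts the torus through \<open>z\<close> into \<open>R\<close>; the bound on
  homogeneous parts holds on all of it, and torus averaging passes it to each term.\<close>

lemma norm_monomial_term_le:
  fixes f :: "complex ^ 'n \<Rightarrow> 'x::cbanach"
  assumes R: "complete_reinhardt_domain R"
    and f: "has_monomial_expansion f x R" "\<And>z. z \<in> R \<Longrightarrow> norm (f z) \<le> B"
    and z: "z \<in> R"
  shows "norm (monomial z \<alpha> *\<^sub>C x \<alpha>) \<le> B"
proof (rule norm_homogeneous_coeff_le[OF _ refl])
  fix w :: "complex ^ 'n"
  assume w: "\<And>i. cmod (w $ i) = cmod (z $ i)"
  have "w \<in> R"
    using R z w unfolding complete_reinhardt_domain_def by (metis order_refl)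
  then show "norm (\<Sum>\<beta> | mdeg \<beta> = mdeg \<alpha>. monomial w \<beta> *\<^sub>C x \<beta>) \<le> B"
    by (intro norm_homogeneous_part_le[OF R f(1)] f(2))
qed

section \<open>An explicit admissible radius\<close>

theorem corollary2:
  fixes R :: "(complex ^ 'n) set" and p :: real
  assumes "complete_reinhardt_domain R" and "0 < p"
  shows "0 < bohr_radius p R (Hinf R :: (complex ^ 'n \<Rightarrow> 'x::cbanach) set)"
proof -
  \<comment> \<open>Chosen so that \<open>n ^ k\<close> terms of size at most \<open>q ^ k\<close>
    add up to at most \<open>(1 / 2) ^ k\<close>.\<close>
  define q :: real where "q = 1 / (2 * real CARD('n))"
  have "1 \<le> 2 * real CARD('n)"
    using zero_less_card_finite[where 'a = 'n] by linarith
  then have q: "0 < q" "q \<le> 1"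
    by (simp_all add: q_def)
  define r where "r = q powr (1 / p)"
  have r: "0 < r" "r \<le> 1" and rp: "r powr p = q"
    using q \<open>0 < p\<close> by (auto simp: r_def powr_powr intro: powr_le1)
  let ?S = "{r. 0 \<le> r \<and> r \<le> 1 \<and>
    (\<forall>f\<in>(Hinf R :: (complex ^ 'n \<Rightarrow> 'x) set). \<forall>x. has_monomial_expansion f x R \<and> sup_norm_on R f \<le> 1 \<longrightarrow>
      (SUP z\<in>(*\<^sub>R) r ` R.
        \<Sum>k. \<Sum>\<alpha> | mdeg \<alpha> = Suc k. ennreal (norm (monomial z \<alpha> *\<^sub>C x \<alpha>) powr p)) \<le> 1)}"
  have "r \<in> ?S"
  proof (intro CollectI conjI ballI allI impI)
    fix f :: "complex ^ 'n \<Rightarrow> 'x" and x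
    assume f: "f \<in> Hinf R" and fx: "has_monomial_expansion f x R \<and> sup_norm_on R f \<le> 1"
    \<comment> \<open>A real \<open>SUP\<close> controls the values only when they are bounded
      above; membership in \<open>Hinf R\<close> supplies this.\<close>
    have "bdd_above ((\<lambda>z. norm (f z)) ` R)"
      using f by (auto simp: Hinf_def bounded_iff intro: bdd_aboveI2)
    then have f_le: "norm (f z) \<le> 1" if "z \<in> R" for z
      using cSUP_upper[OF that] fx unfolding sup_norm_on_def by fastforce
    have term_le: "norm (monomial (r *\<^sub>R z) \<alpha> *\<^sub>C x \<alpha>) powr p \<le> q ^ mdeg \<alpha>" if "z \<in> R" for z \<alpha>
    proof -
      have "norm (monomial (r *\<^sub>R z) \<alpha> *\<^sub>C x \<alpha>) = r ^ mdeg \<alpha> * norm (monomial z \<alpha> *\<^sub>C x \<alpha>)"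
        using r by (simp add: scaleR_vec_eq monomial_scale_const norm_scaleC norm_mult norm_power)
      also have "\<dots> \<le> r ^ mdeg \<alpha>"
        using norm_monomial_term_le[OF assms(1) conjunct1[OF fx] _ that, of 1 \<alpha>] f_le r
        by (intro mult_left_le) auto
      finally have "norm (monomial (r *\<^sub>R z) \<alpha> *\<^sub>C x \<alpha>) powr p \<le> (r ^ mdeg \<alpha>) powr p"
        using \<open>0 < p\<close> by (intro powr_mono2) auto
      also have "\<dots> = q ^ mdeg \<alpha>"
        using r by (simp add: rp[symmetric] powr_powr mult.commute flip: powr_realpow)
      finally show ?thesis .
    qed
    show "(SUP z\<in>(*\<^sub>R) r ` R.
        \<Sum>k. \<Sum>\<alpha> | mdeg \<alpha> = Suc k. ennreal (norm (monomial z \<alpha> *\<^sub>C x \<alpha>) powr p)) \<le> 1"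
    proof (rule SUP_least, elim imageE, simp only:)
      fix z assume z: "z \<in> R"
      have deg: "(\<Sum>\<alpha> | mdeg \<alpha> = Suc k. ennreal (norm (monomial (r *\<^sub>R z) \<alpha> *\<^sub>C x \<alpha>) powr p))
          \<le> ennreal ((1 / 2) ^ Suc k)" for k
      proof -
        have "(\<Sum>\<alpha> | mdeg \<alpha> = Suc k. norm (monomial (r *\<^sub>R z) \<alpha> *\<^sub>C x \<alpha>) powr p)
            \<le> (\<Sum>\<alpha> :: 'n \<Rightarrow> nat | mdeg \<alpha> = Suc k. q ^ Suc k)"
          by (intro sum_mono) (metis (lifting) term_le z mem_Collect_eq)
        also have "\<dots> \<le> real CARD('n) ^ Suc k * q ^ Suc k"
          unfolding sum_constant of_nat_power[symmetric]
          using card_mdeg_le[where 'n = 'n, of "Suc k"] q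
          by (intro mult_right_mono of_nat_mono) auto
        also have "\<dots> = (1 / 2) ^ Suc k"
          by (simp only: power_mult_distrib[symmetric]) (simp add: q_def)
        finally show ?thesis
          by (subst sum_ennreal) (auto intro!: ennreal_leI)
      qed
      have "(\<Sum>k. \<Sum>\<alpha> | mdeg \<alpha> = Suc k. ennreal (norm (monomial (r *\<^sub>R z) \<alpha> *\<^sub>C x \<alpha>) powr p))
          \<le> (\<Sum>k. ennreal ((1 / 2) ^ Suc k))"
        by (intro suminf_le deg) auto
      \<comment> \<open>The series starts in degree one, so the halves add up to exactly 1.\<close>
      also have "\<dots> = ennreal 1"
        by (rule suminf_ennreal_eq[OF _ power_half_series]) simp
      finally show "(\<Sum>k. \<Sum>\<alpha> | mdeg \<alpha> = Suc k.
          ennreal (norm (monomial (r *\<^sub>R z) \<alpha> *\<^sub>C x \<alpha>) powr p)) \<le> 1"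
        by simp
    qed
  qed (use r in auto)
  \<comment> \<open>Likewise, \<open>Sup\<close> dominates \<open>r\<close> once the set is bounded
    above.\<close>
  moreover have "bdd_above ?S"
    by (rule bdd_aboveI[of _ 1]) auto
  ultimately have "r \<le> bohr_radius p R (Hinf R :: (complex ^ 'n \<Rightarrow> 'x) set)"
    unfolding bohr_radius_def by (intro cSup_upper)
  with r show ?thesis by simp
qed

end
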